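(* Let $q$ be a prime power, $s\geq 4$ an even integer, $n=\frac{q^{2s}-1}{q+1}$, and let $\delta$ be an integer with $\left\lceil\frac{q}{2}\right\rceil q^{s-1}+1\leq\delta\leq\frac{q^{s+1}+1}{q+1}$. Then the dimension $k$ of $\mathcal{C}_{(q,n,\delta)}$ is as follows. (1) If $2\mid q$, then $$k=n-2s\left(\delta+\frac{q-2}{2}-\left\lfloor\frac{(\delta-1)(q+1)}{q^{s}}\right\rfloor\right)+2s\left\lfloor\frac{\delta-1}{q}\right\rfloor.$$ (2) If $2\nmid q$, then $$k=n-2s\left(\delta+\frac{q-1}{2}-\left\lfloor\frac{(\delta-1)(q+1)}{q^{s}}\right\rfloor\right)+2s\left\lfloor\frac{\delta-1}{q}\right\rfloor+s.$$
   Context: Let $\alpha$ be a generator of $\mathbb{F}_{q^{2s}}^*$ and $\beta_1=\alpha^{q+1}$, a primitive $n$-th root of unity. For an integer $j$ let $m_j(x)$ be the minimal polynomial of $\beta_1^j$ over $\mathbb{F}_q$. For $2\le\delta\le n$, the narrow-sense BCH code $\mathcal{C}_{(q,n,\delta)}$ is the cyclic code of length $n$ over $\mathbb{F}_q$ (an ideal of $\mathbb{F}_q[x]/\langle x^n-1\rangle$) generated by $\mathrm{lcm}(m_1(x),\dots,m_{\delta-1}(x))$. *)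

theory Defs
  imports
    Complex_Main
    "HOL-Library.Cardinality"
    "HOL-Computational_Algebra.Computational_Algebra"
    "HOL-Number_Theory.Prime_Powers"
begin

definition field_embedding :: "('k::field \<Rightarrow> 'l::field) \<Rightarrow> bool" where
  "field_embedding \<phi> \<longleftrightarrow>
     \<phi> 1 = 1 \<and> (\<forall>x y. \<phi> (x + y) = \<phi> x + \<phi> y) \<and> (\<forall>x y. \<phi> (x * y) = \<phi> x * \<phi> y)"

definition field_generator :: "'l::field \<Rightarrow> bool" where
  "field_generator \<alpha> \<longleftrightarrow> range (\<lambda>i::nat. \<alpha> ^ i) = UNIV - {0}"

(* The monic polynomial of least degree that annihilates x, for the extension given by the
   embedding \<phi>.  It exists and is unique whenever x is algebraic over the image of \<phi>, in
   particular when the extension field is finite. *)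
definition min_poly :: "('k::field \<Rightarrow> 'l::field) \<Rightarrow> 'l \<Rightarrow> 'k poly" where
  "min_poly \<phi> x = (THE p. lead_coeff p = 1 \<and> poly (map_poly \<phi> p) x = 0 \<and>
     (\<forall>r. r \<noteq> 0 \<and> poly (map_poly \<phi> r) x = 0 \<longrightarrow> degree p \<le> degree r))"

(* The principal ideal generated by g in the quotient of the polynomial ring by x^n - 1, where
   each residue class is represented by its remainder modulo x^n - 1. *)
definition cyclic_code :: "nat \<Rightarrow> 'k::field poly \<Rightarrow> 'k poly set" where
  "cyclic_code n g = range (\<lambda>h. (g * h) mod (monom 1 n - 1))"

(* The sort field_gcd is what the library requires for Lcm on polynomials; it does not restrict
   the field, since on every field these extra operations can be defined in the trivial way. *)
definition bch_code ::
  "('k::field_gcd \<Rightarrow> 'l::field) \<Rightarrow> 'l \<Rightarrow> nat \<Rightarrow> nat \<Rightarrow> 'k poly set" where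
  "bch_code \<phi> \<beta> n \<delta> = cyclic_code n (Lcm ((\<lambda>j. min_poly \<phi> (\<beta> ^ j)) ` {1..\<delta> - 1}))"

(* vector_space.dim below refers to the coefficientwise action of the scalars. *)
lemma vector_space_smult: "vector_space (smult :: 'k::field \<Rightarrow> 'k poly \<Rightarrow> 'k poly)"
  by unfold_locales (simp_all add: smult_add_right smult_add_left)

definition code_dim :: "'k::field poly set \<Rightarrow> nat" where
  "code_dim C = vector_space.dim smult C"

end

(* The dimension is n minus the number of roots of the generator polynomial, and these roots are
   the Frobenius orbits of beta^1, ..., beta^(delta - 1).  Writing beta^i as alpha^((q + 1) i), an
   orbit corresponds to the cyclic rotations of the 2s-digit base-q expansion of (q + 1) i.  For
   i < delta this expansion has at least s - 1 leading zeros, so two indices i, i' that are not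
   multiples of q lie in the same orbit only via the half turn: (q + 1) i = a q^s + b and
   (q + 1) i' = b q^s + a with digits a, b.  As s is even, divisibility by q + 1 means
   a + b = q + 1.  Hence the redundant indices are those with a > b, one for each a between
   (q + 1)/2 and (delta - 1)(q + 1)/q^s, and the only short orbit (of length s) has a = b, which
   requires q odd. *)
theory Submission
  imports Defs "HOL-Number_Theory.Cong"
begin

text \<open>The library fact \<open>finite_field_power_card_eq_same\<close> requires the sort \<open>finite_field\<close>, which the
  sort \<open>{finite,field}\<close> does not entail for type inference.\<close>

lemma finite_field_power_card:
  fixes x :: "'a::{finite,field}"
  shows "x ^ CARD('a) = x"
proof (cases "x = 0")
  case False
  \<comment> \<open>Multiplication by \<open>x\<close> permutes the nonzero elements; comparing
    their product before and after gives \<open>x ^ card ?U = 1\<close>.\<close>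
  let ?U = "UNIV - {0::'a}"
  have "(*) x ` ?U = ?U"
    using False by (intro endo_inj_surj) (auto simp: inj_on_def)
  then have "\<Prod>?U = (\<Prod>y\<in>?U. x * y)"
    using False prod.reindex[of "(*) x" ?U id] by (simp add: inj_on_def)
  then have "x ^ card ?U * \<Prod>?U = \<Prod>?U"
    unfolding prod.distrib prod_constant by (rule sym)
  then have "x ^ card ?U = 1"
    by simp
  then have "x ^ Suc (card ?U) = x"
    unfolding power_Suc by (rule arg_cong[where f = "(*) x", THEN trans]) simp
  moreover have "Suc (card ?U) = CARD('a)"
    by (simp add: card_Diff_subset card_gt_0_iff)
  ultimately show ?thesis
    by metis
qed (simp add: finite_UNIV_card_ge_0)

text \<open>Translation by 1 permutes the ring, so summing all elements before and after forces the
  sum of all these ones to vanish. Hence the characteristic divides the cardinality.\<close>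

lemma of_nat_CARD_eq_0: "of_nat CARD('a) = (0::'a::{finite,ring_1})"
proof -
  have "bij (\<lambda>x::'a. x + 1)"
    by (rule bij_betw_byWitness[where f' = "\<lambda>x. x - 1"]) auto
  then have "(\<Sum>x\<in>UNIV. x + 1) = (\<Sum>x\<in>UNIV. x :: 'a)"
    by (rule sum.reindex_bij_betw)
  then show ?thesis
    by (simp add: sum.distrib)
qed

subsection \<open>Field embeddings and their action on polynomials\<close>

context
  fixes \<phi> :: "'k::field \<Rightarrow> 'l::field"
  assumes emb: "field_embedding \<phi>"
begin

lemma emb_1: "\<phi> 1 = 1"
  and emb_add: "\<phi> (x + y) = \<phi> x + \<phi> y"
  and emb_mult: "\<phi> (x * y) = \<phi> x * \<phi> y"
  using emb by (auto simp: field_embedding_def)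

lemma emb_0: "\<phi> 0 = 0"
  using emb_add[of 0 0] by (metis add_cancel_right_right add_0)

lemma emb_minus: "\<phi> (- x) = - \<phi> x"
  using emb_add[of "- x" x] by (simp add: emb_0 eq_neg_iff_add_eq_0)

lemma emb_diff: "\<phi> (x - y) = \<phi> x - \<phi> y"
  using emb_add[of x "- y"] by (simp add: emb_minus)

lemma emb_eq_0_iff: "\<phi> x = 0 \<longleftrightarrow> x = 0"
proof
  assume "\<phi> x = 0"
  then have "\<phi> (x * inverse x) = 0"
    by (simp add: emb_mult)
  then show "x = 0"
    by (cases "x = 0") (auto simp: emb_1)
qed (simp add: emb_0)

lemma inj_emb: "inj \<phi>"
  by (rule injI) (metis emb_diff emb_eq_0_iff right_minus_eq)

lemma emb_power: "\<phi> (x ^ m) = \<phi> x ^ m"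
  by (induction m) (auto simp: emb_1 emb_mult)

lemma emb_sum: "\<phi> (sum f S) = (\<Sum>x\<in>S. \<phi> (f x))"
  by (induction S rule: infinite_finite_induct) (auto simp: emb_0 emb_add)

lemma emb_of_nat: "\<phi> (of_nat m) = of_nat m"
  by (induction m) (auto simp: emb_0 emb_1 emb_add)

lemma emb_CHAR: "CHAR('l) = CHAR('k)"
proof -
  have "(of_nat m = (0::'l)) = (of_nat m = (0::'k))" for m
    using emb_eq_0_iff[of "of_nat m"] by (simp add: emb_of_nat)
  then show ?thesis
    by (intro CHAR_eqI) (auto simp: of_nat_eq_0_iff_char_dvd)
qed

lemma coeff_emb: "coeff (map_poly \<phi> p) i = \<phi> (coeff p i)"
  by (simp add: coeff_map_poly emb_0)

lemma map_poly_emb_diff: "map_poly \<phi> (p - r) = map_poly \<phi> p - map_poly \<phi> r"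
  by (rule poly_eqI) (simp add: coeff_emb emb_diff)

lemma map_poly_emb_mult: "map_poly \<phi> (p * r) = map_poly \<phi> p * map_poly \<phi> r"
  by (rule poly_eqI) (simp add: coeff_emb coeff_mult emb_sum emb_mult)

lemma map_poly_emb_prod: "map_poly \<phi> (prod f S) = (\<Prod>x\<in>S. map_poly \<phi> (f x))"
  by (induction S rule: infinite_finite_induct) (auto simp: emb_1 map_poly_emb_mult)

lemma degree_map_poly_emb: "degree (map_poly \<phi> p) = degree p"
  by (rule degree_map_poly) (simp add: emb_eq_0_iff)

lemma map_poly_emb_eq_0_iff: "map_poly \<phi> p = 0 \<longleftrightarrow> p = 0"
  by (rule map_poly_eq_0_iff) (auto simp: emb_eq_0_iff)

lemma root_map_poly_dvd: "p dvd r \<Longrightarrow> poly (map_poly \<phi> p) z = 0 \<Longrightarrow> poly (map_poly \<phi> r) z = 0"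
  by (auto simp: map_poly_emb_mult)

text \<open>The annihilator \<open>p0\<close> guarantees one of least degree. Dividing any
  annihilator by it leaves an annihilating remainder of smaller degree, hence 0. A second monic one
  of least degree is then a constant multiple with constant 1, so the description in
  \<open>min_poly\<close> is met by exactly one polynomial.\<close>

lemma min_poly_props:
  assumes "p0 \<noteq> 0" "poly (map_poly \<phi> p0) z = 0"
  shows "lead_coeff (min_poly \<phi> z) = 1" "poly (map_poly \<phi> (min_poly \<phi> z)) z = 0"
    and "\<And>r. poly (map_poly \<phi> r) z = 0 \<Longrightarrow> min_poly \<phi> z dvd r"
proof -
  define minimal where "minimal p \<longleftrightarrow> lead_coeff p = 1 \<and> poly (map_poly \<phi> p) z = 0 \<and>
     (\<forall>r. r \<noteq> 0 \<and> poly (map_poly \<phi> r) z = 0 \<longrightarrow> degree p \<le> degree r)" for p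
  have dvd: "p dvd r" if p: "minimal p" and r: "poly (map_poly \<phi> r) z = 0" for p r
  proof -
    have "p \<noteq> 0"
      using p by (auto simp: minimal_def)
    have "r mod p = r - p * (r div p)"
      by (simp add: minus_mult_div_eq_mod)
    then have "poly (map_poly \<phi> (r mod p)) z = 0"
      using p r by (simp add: map_poly_emb_diff map_poly_emb_mult minimal_def)
    then have "r mod p = 0"
      using p degree_mod_less[OF \<open>p \<noteq> 0\<close>, of r] by (auto simp: minimal_def not_less)
    then show ?thesis
      by (simp add: mod_eq_0_iff_dvd)
  qed
  obtain p where p: "p \<noteq> 0" "poly (map_poly \<phi> p) z = 0"
    and least: "\<And>r. r \<noteq> 0 \<Longrightarrow> poly (map_poly \<phi> r) z = 0 \<Longrightarrow> degree p \<le> degree r"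
    using ex_has_least_nat[of "\<lambda>p. p \<noteq> 0 \<and> poly (map_poly \<phi> p) z = 0" p0 degree] assms
    by blast
  have "minimal (smult (inverse (lead_coeff p)) p)"
    using p least by (auto simp: minimal_def map_poly_smult emb_0 emb_mult)
  moreover have "p = r" if p: "minimal p" and r: "minimal r" for p r
  proof -
    have "p dvd r"
      using p r by (intro dvd) (auto simp: minimal_def)
    then obtain c where c: "r = p * c" ..
    have "p \<noteq> 0" "r \<noteq> 0"
      using p r by (auto simp: minimal_def)
    moreover from this have "degree r \<le> degree p"
      using p r by (simp add: minimal_def)
    ultimately have "degree c = 0"
      using c degree_mult_eq[of p c] by auto
    then obtain e where e: "c = [:e:]"
      by (rule degree_eq_zeroE)
    then have "lead_coeff r = lead_coeff p * e"
      using c by (simp add: lead_coeff_mult)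
    then have "e = 1"
      using p r by (simp add: minimal_def)
    then show ?thesis
      using c e by simp
  qed
  ultimately have "minimal (min_poly \<phi> z)"
    unfolding min_poly_def minimal_def[symmetric] by (metis theI')
  then show "lead_coeff (min_poly \<phi> z) = 1" "poly (map_poly \<phi> (min_poly \<phi> z)) z = 0"
    "\<And>r. poly (map_poly \<phi> r) z = 0 \<Longrightarrow> min_poly \<phi> z dvd r"
    using dvd by (auto simp: minimal_def)
qed

end

subsection \<open>Frobenius orbits\<close>

context
  fixes \<phi> :: "'k::{finite,field} \<Rightarrow> 'l::{finite,field}"
  assumes emb: "field_embedding \<phi>"
    and primepow: "primepow CARD('k)"
begin

text \<open>The cardinality of the base field is a power of its characteristic, which the extension
  shares; additivity is then the freshman's dream.\<close>

lemma field_embedding_frobenius: "field_embedding (\<lambda>x::'l. x ^ CARD('k))"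
proof -
  have char: "prime CHAR('k)"
    by (intro prime_CHAR_semidom finite_imp_CHAR_pos) simp
  obtain p m where p: "prime p" "CARD('k) = p ^ m"
    using primepow by (auto simp: primepow_def)
  have "CHAR('k) dvd p ^ m"
    using of_nat_CARD_eq_0[where 'a='k] p by (metis of_nat_eq_0_iff_char_dvd)
  then have "CHAR('k) = p"
    using char p primes_dvd_imp_eq prime_dvd_power by blast
  then have "CHAR('l) = p"
    by (simp add: emb_CHAR[OF emb])
  then show ?thesis
    using p freshmans_dream'[where 'a='l, of _ m]
    by (auto simp: field_embedding_def power_mult_distrib)
qed

text \<open>The right-hand side is the root set of \<open>x ^ q - x\<close> for
  \<open>q = CARD('k)\<close>, so it has at most \<open>q\<close> elements, and the image of the
  injective \<open>\<phi>\<close> already supplies that many.\<close>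

lemma range_emb: "range \<phi> = {y. y ^ CARD('k) = y}"
proof (rule card_seteq)
  show "range \<phi> \<subseteq> {y. y ^ CARD('k) = y}"
    by (auto simp flip: emb_power[OF emb] simp: finite_field_power_card)
  let ?p = "monom 1 CARD('k) - monom (1::'l) 1"
  have "CARD('k) > 1"
    using primepow by (simp add: primepow_gt_Suc_0)
  then have "degree ?p \<le> CARD('k)" and "coeff ?p CARD('k) = 1"
    by (auto intro!: degree_diff_le degree_monom_le[THEN order_trans])
  moreover from this have "?p \<noteq> 0"
    by (metis coeff_0 zero_neq_one)
  ultimately have "card {y. poly ?p y = 0} \<le> CARD('k)"
    by (metis card_poly_roots_bound order_trans)
  then show "card {y::'l. y ^ CARD('k) = y} \<le> card (range \<phi>)"
    by (simp add: poly_monom card_image[OF inj_emb[OF emb]])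
qed simp

text \<open>Frobenius is additive and fixes the coefficients of \<open>map_poly \<phi> p\<close>, so
  it commutes with evaluating this polynomial and carries roots to roots.\<close>

lemma root_power_CARD:
  assumes "poly (map_poly \<phi> p) z = 0"
  shows "poly (map_poly \<phi> p) (z ^ CARD('k) ^ t) = 0"
proof (induction t)
  case (Suc t)
  define y where "y = z ^ CARD('k) ^ t"
  have "poly (map_poly \<phi> p) (y ^ CARD('k)) = (\<Sum>i\<le>degree p. (\<phi> (coeff p i) * y ^ i) ^ CARD('k))"
    by (simp add: poly_altdef degree_map_poly_emb[OF emb] coeff_emb[OF emb] power_mult_distrib
        finite_field_power_card mult.commute flip: emb_power[OF emb] power_mult)
  also have "\<dots> = poly (map_poly \<phi> p) y ^ CARD('k)"
    by (simp add: poly_altdef degree_map_poly_emb[OF emb] coeff_emb[OF emb]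
        emb_sum[OF field_embedding_frobenius])
  also have "\<dots> = 0"
    using Suc.IH by (simp add: y_def)
  finally show ?case
    by (simp add: y_def mult.commute flip: power_mult)
qed (use assms in simp)

text \<open>Frobenius is injective, so it permutes the finite set \<open>Z\<close> and with it the
  linear factors. The coefficients of the product are therefore fixed and come from the base field
  by \<open>range_emb\<close>.\<close>

lemma frobenius_closed_descent:
  fixes Z :: "'l set"
  assumes "(\<lambda>z. z ^ CARD('k)) ` Z \<subseteq> Z"
  obtains h where "map_poly \<phi> h = (\<Prod>z\<in>Z. [:-z, 1:])"
proof
  let ?F = "\<lambda>x::'l. x ^ CARD('k)" and ?G = "\<Prod>z\<in>Z. [:-z, 1:]"
  note F = field_embedding_frobenius
  have inj: "inj_on ?F Z"
    using inj_emb[OF F] by (rule inj_on_subset) simp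
  have "map_poly ?F ?G = (\<Prod>z\<in>Z. [:- ?F z, 1:])"
    by (simp add: map_poly_emb_prod[OF F] map_poly_pCons emb_0[OF F] emb_minus[OF F])
  also have "\<dots> = ?G"
    using prod.reindex[OF inj, of "\<lambda>z. [:-z, 1:]"] endo_inj_surj[OF _ assms inj] by simp
  finally have "?F (coeff ?G i) = coeff ?G i" for i
    by (metis coeff_emb[OF F])
  then have "coeff ?G i \<in> range \<phi>" for i
    by (simp add: range_emb)
  then have "\<phi> (inv \<phi> (coeff ?G i)) = coeff ?G i" for i
    by (simp add: f_inv_into_f)
  \<comment> \<open>This makes \<open>map_poly (inv \<phi>)\<close> act on every coefficient, those
    beyond the degree included.\<close>
  moreover have "inv \<phi> 0 = 0"
    by (metis emb_0[OF emb] inj_emb[OF emb] inv_f_f)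
  ultimately show "map_poly \<phi> (map_poly (inv \<phi>) ?G) = ?G"
    by (intro poly_eqI) (simp add: coeff_emb[OF emb] coeff_map_poly)
qed

end

section \<open>Degree of the generator polynomial and dimension of a cyclic code\<close>

text \<open>The set \<open>?Z\<close> is the union of the Frobenius orbits of \<open>A\<close>. The
  product over \<open>?Z\<close> descends to a common multiple of the minimal polynomials, which
  bounds the degree from above; every element of \<open>?Z\<close> is a root of the
  \<open>Lcm\<close>, which bounds it from below.\<close>

lemma degree_Lcm_min_poly:
  fixes \<phi> :: "'k::{finite,field_gcd} \<Rightarrow> 'l::{finite,field}"
  assumes emb: "field_embedding \<phi>" and primepow: "primepow CARD('k)"
  shows "degree (Lcm (min_poly \<phi> ` A)) = card {x ^ CARD('k) ^ t |x t. x \<in> A}"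
proof -
  let ?Z = "{x ^ CARD('k) ^ t |x t. x \<in> A}" and ?g = "Lcm (min_poly \<phi> ` A)"
  have "(\<lambda>z. z ^ CARD('k)) ` ?Z \<subseteq> ?Z"
  proof clarify
    fix x t assume "x \<in> A"
    moreover have "(x ^ CARD('k) ^ t) ^ CARD('k) = x ^ CARD('k) ^ Suc t"
      by (simp add: mult.commute flip: power_mult)
    ultimately show "\<exists>y u. (x ^ CARD('k) ^ t) ^ CARD('k) = y ^ CARD('k) ^ u \<and> y \<in> A"
      by blast
  qed
  then obtain h where h: "map_poly \<phi> h = (\<Prod>z\<in>?Z. [:-z, 1:])"
    using frobenius_closed_descent[OF emb primepow] by blast
  have deg: "degree h = card ?Z"
    by (simp add: h degree_prod_sum_eq flip: degree_map_poly_emb[OF emb])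
  have "h \<noteq> 0"
    using h by (auto simp flip: map_poly_emb_eq_0_iff[OF emb])
  have "A \<subseteq> ?Z"
    by clarify (metis power_0 power_one_right)
  then have root: "poly (map_poly \<phi> h) x = 0" if "x \<in> A" for x
    using that by (auto simp: h poly_prod)
  note props = min_poly_props[OF emb \<open>h \<noteq> 0\<close> root]
  have "?g dvd h"
    using props(3)[OF _ root] by (intro Lcm_least) auto
  then have g: "?g \<noteq> 0" "degree ?g \<le> card ?Z"
    using \<open>h \<noteq> 0\<close> deg by (auto dest: dvd_imp_degree_le)
  have "?Z \<subseteq> {z. poly (map_poly \<phi> ?g) z = 0}"
    by (auto intro!: root_power_CARD[OF emb primepow] root_map_poly_dvd[OF emb _ props(2)] dvd_Lcm)
  then have "card ?Z \<le> card {z. poly (map_poly \<phi> ?g) z = 0}"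
    by (intro card_mono) auto
  also have "\<dots> \<le> degree ?g"
    using card_poly_roots_bound[of "map_poly \<phi> ?g"] g
    by (simp add: map_poly_emb_eq_0_iff[OF emb] degree_map_poly_emb[OF emb])
  finally show ?thesis
    using g by simp
qed

text \<open>The shifts \<open>g * monom 1 i\<close> with \<open>i < n - degree g\<close> form a
  basis. With \<open>c\<close> the cofactor of \<open>g\<close>, a product \<open>g * h\<close>
  reduces to \<open>g * (h mod c)\<close>, and a nonzero \<open>h mod c\<close> has degree below
  \<open>degree c = n - degree g\<close>.\<close>

lemma code_dim_cyclic_code:
  fixes g :: "'k::field poly"
  assumes "n > 0" "g dvd monom 1 n - 1"
  shows "code_dim (cyclic_code n g) + degree g = n"
proof -
  interpret vector_space "smult :: 'k \<Rightarrow> 'k poly \<Rightarrow> 'k poly"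
    by (rule vector_space_smult)
  define m where "m = n - degree g"
  let ?f = "monom 1 n - 1 :: 'k poly"
  let ?b = "\<lambda>i. g * monom 1 i" and ?B = "(\<lambda>i. g * monom 1 i) ` {..<m}"
  obtain c where c: "?f = g * c"
    using assms by blast
  have "degree ?f = n"
    using assms(1) degree_add_eq_left[of "- 1" "monom (1::'k) n"] by (simp add: degree_monom_eq)
  then have "?f \<noteq> 0"
    using assms(1) by (metis degree_0 less_numeral_extra(3))
  then have nz: "g \<noteq> 0" "c \<noteq> 0"
    using c by auto
  then have deg: "degree g + degree c = n"
    using \<open>degree ?f = n\<close> degree_mult_eq[of g c] c by simp
  have inj: "inj_on ?b {..<m}"
    using nz by (auto simp: inj_on_def monom_eq_iff')
  have "?B \<subseteq> cyclic_code n g"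
  proof clarify
    fix i assume "i < m"
    then have "degree (?b i) < n"
      using nz by (simp add: m_def degree_mult_eq degree_monom_eq)
    then have "?b i = ?b i mod ?f"
      using \<open>degree ?f = n\<close> by (simp add: mod_poly_less)
    then show "?b i \<in> cyclic_code n g"
      unfolding cyclic_code_def by blast
  qed
  moreover have "cyclic_code n g \<subseteq> span ?B"
  proof (clarsimp simp: cyclic_code_def)
    fix h
    have "degree (h mod c) < m" if "h mod c \<noteq> 0"
      using degree_mod_less'[OF \<open>c \<noteq> 0\<close> that] deg by (simp add: m_def)
    then have "h mod c = (\<Sum>i<m. monom (coeff (h mod c) i) i)"
      by (cases "h mod c = 0") (auto simp: poly_eq_iff coeff_sum coeff_eq_0)
    then have "g * h mod ?f = (\<Sum>i<m. smult (coeff (h mod c) i) (?b i))"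
      unfolding c by (metis (no_types, lifting) mult_mod_right sum_distrib_left mult_smult_right
          smult_monom mult.right_neutral sum.cong)
    also have "\<dots> \<in> span ?B"
      by (intro span_sum span_scale span_base) auto
    finally show "g * h mod ?f \<in> span ?B" .
  qed
  moreover have "independent ?B"
  proof (rule independent_if_scalars_zero)
    fix u x assume "(\<Sum>x\<in>?B. smult (u x) x) = 0" and x: "x \<in> ?B"
    then have "(\<Sum>i<m. smult (u (?b i)) (?b i)) = 0"
      by (simp add: sum.reindex[OF inj])
    then have "g * (\<Sum>i<m. monom (u (?b i)) i) = 0"
      by (simp add: sum_distrib_left smult_monom flip: mult_smult_right)
    then have "(\<Sum>i<m. monom (u (?b i)) i) = 0"
      using nz by simp
    then have "coeff (\<Sum>i<m. monom (u (?b i)) i) j = 0" for j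
      by simp
    then have "u (?b j) = 0" if "j < m" for j
      using that \<open>\<And>j. coeff (\<Sum>i<m. monom (u (?b i)) i) j = 0\<close>[of j] by (simp add: coeff_sum)
    then show "u x = 0"
      using x by auto
  qed simp
  moreover have "card ?B = m"
    by (simp add: card_image[OF inj])
  ultimately have "code_dim (cyclic_code n g) = m"
    unfolding code_dim_def by (rule dim_unique)
  then show ?thesis
    using deg by (simp add: m_def)
qed

subsection \<open>Cyclotomic cosets of small integers\<close>

text \<open>A shift by at most \<open>s - 1\<close> digits never wraps around: the largest value is
  \<open>q ^ (2 * s) - q ^ (s - 1)\<close>, and \<open>s \<ge> 2\<close> gives
  \<open>q ^ (s - 1) > 1\<close>.\<close>

lemma mult_power_less_modulus:
  fixes q s I u :: nat
  assumes "q \<ge> 2" "s \<ge> 2" "I < q ^ (s + 1)" "u < s"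
  shows "I * q ^ u < q ^ (2 * s) - 1"
proof -
  have "I * q ^ u \<le> (q ^ (s + 1) - 1) * q ^ (s - 1)"
    using assms by (intro mult_mono power_increasing) auto
  also have "\<dots> = q ^ (s + 1) * q ^ (s - 1) - q ^ (s - 1)"
    by (simp add: diff_mult_distrib)
  also have "q ^ (s + 1) * q ^ (s - 1) = q ^ (2 * s)"
    unfolding power_add[symmetric] using assms by (intro arg_cong[where f = "(^) q"]) simp
  finally have "I * q ^ u \<le> q ^ (2 * s) - q ^ (s - 1)" .
  moreover have "1 < q ^ (s - 1)" "q ^ (s - 1) \<le> q ^ (2 * s)"
    using assms one_less_power[of q "s - 1"] by (auto intro: power_increasing)
  ultimately show ?thesis
    by linarith
qed

text \<open>In base \<open>q\<close>, multiplication by \<open>q\<close> modulo \<open>q ^ (2 * s) - 1\<close> rotates the \<open>2 * s\<close> digits.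
  A number below \<open>q ^ (s + 1)\<close> has \<open>s - 1\<close> leading zeros, and a rotation that keeps them
  while leaving a nonzero last digit must be the half turn.\<close>

lemma cong_rotation:
  fixes q s I I' u :: nat
  assumes q: "q \<ge> 2" and s: "s \<ge> 2"
    and I: "I < q ^ (s + 1)" "\<not> q dvd I" and I': "I' < q ^ (s + 1)" "\<not> q dvd I'"
    and u: "0 < u" "u < 2 * s"
    and cong: "[I = I' * q ^ u] (mod (q ^ (2 * s) - 1))"
  obtains a b where "u = s" "a < q" "b < q" "I = b * q ^ s + a" "I' = a * q ^ s + b"
proof -
  let ?N = "q ^ (2 * s) - 1"
  have "I < ?N" "I' < ?N"
    using mult_power_less_modulus[of q s _ 0] assms by auto
  have pow1: "[q ^ (2 * s) = 1] (mod ?N)"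
    using q by (simp add: cong_altdef_nat)
  consider "u < s" | "u > s" | "u = s"
    by linarith
  then show ?thesis
  proof cases
    \<comment> \<open>The shift does not wrap, so the congruence is an equality and \<open>q\<close>
      would divide \<open>I\<close>.\<close>
    case 1
    then have "I = I' * q ^ u"
      using cong mult_power_less_modulus[of q s I' u] \<open>I < ?N\<close> assms
      by (auto simp: cong_def)
    then show ?thesis
      using I u by auto
  next
    \<comment> \<open>Completing the full turn exchanges the roles: \<open>I'\<close> is
      \<open>I\<close> shifted by \<open>2 * s - u < s\<close> digits, and \<open>q\<close> would
      divide \<open>I'\<close>.\<close>
    case 2
    have "[I * q ^ (2 * s - u) = I' * q ^ u * q ^ (2 * s - u)] (mod ?N)"
      using cong by (rule cong_scalar_right)
    also have "I' * q ^ u * q ^ (2 * s - u) = I' * q ^ (2 * s)"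
      using u by (simp add: mult.assoc flip: power_add)
    also have "[\<dots> = I' * 1] (mod ?N)"
      using pow1 by (rule cong_scalar_left)
    finally have "I * q ^ (2 * s - u) = I'"
      using mult_power_less_modulus[of q s I "2 * s - u"] \<open>I' < ?N\<close> assms 2
      by (auto simp: cong_def)
    then show ?thesis
      using I' u by auto
  next
    \<comment> \<open>The half turn exchanges the upper part \<open>a\<close> and the lower part
      \<open>b\<close> of \<open>I'\<close>; as \<open>b\<close> becomes the upper part of
      \<open>I\<close>, the bound on \<open>I\<close> cuts it down to one digit.\<close>
    case 3
    define a b where "a = I' div q ^ s" and "b = I' mod q ^ s"
    have I'_eq: "I' = a * q ^ s + b"
      by (simp only: a_def b_def div_mult_mod_eq)
    have "a < q"
      using I' by (simp add: a_def less_mult_imp_div_less)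
    have "b < q ^ s"
      using q by (simp add: b_def)
    have "[I = I' * q ^ s] (mod ?N)"
      using cong 3 by simp
    also have "I' * q ^ s = a * q ^ (2 * s) + b * q ^ s"
      by (simp add: I'_eq mult_2 power_add add_mult_distrib)
    also have "[\<dots> = a * 1 + b * q ^ s] (mod ?N)"
      using pow1 by (intro cong_add cong_scalar_left cong_refl)
    finally have "[I = b * q ^ s + a] (mod ?N)"
      by (simp add: add.commute)
    moreover have "b * q ^ s + a < ?N"
    proof -
      have "(b + 1) * q ^ s \<le> q ^ s * q ^ s"
        using \<open>b < q ^ s\<close> by (intro mult_right_mono) auto
      moreover have "q ^ 1 < q ^ s"
        using q s by (intro power_strict_increasing) auto
      ultimately show ?thesis
        using \<open>a < q\<close> by (simp add: mult_2 power_add)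
    qed
    ultimately have I_eq: "I = b * q ^ s + a"
      using \<open>I < ?N\<close> by (simp add: cong_def)
    then have "b * q ^ s < q ^ (s + 1)"
      using I by linarith
    then have "b < q"
      by simp
    then show ?thesis
      using that 3 \<open>a < q\<close> I_eq I'_eq by blast
  qed
qed

lemma two_digits_unique:
  fixes q s :: nat
  assumes "a * q ^ s + b = a' * q ^ s + b'" "b < q" "b' < q" "s > 0"
  shows "a = a'" "b = b'"
proof -
  have "q \<le> q ^ s"
    using assms(2,4) by (intro self_le_power) auto
  then have digit: "(c * q ^ s + d) div q ^ s = c" if "d < q" for c d
    using that by simp
  show "a = a'"
    using digit[OF assms(2), of a] digit[OF assms(3), of a'] by (simp only: assms(1))
  then show "b = b'"
    using assms(1) by simp
qed

text \<open>Modulo \<open>q + 1\<close> the base \<open>q\<close> is -1, so its even power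
  \<open>q ^ s\<close> is 1.\<close>

lemma dvd_two_digits_iff:
  fixes q s :: nat
  assumes "even s"
  shows "q + 1 dvd a * q ^ s + b \<longleftrightarrow> q + 1 dvd a + b"
proof -
  have "[q * q = 1] (mod (q + 1))"
  proof (cases q)
    case (Suc m)
    then have "q * q = 1 + m * (q + 1)"
      by simp
    then show ?thesis
      unfolding cong_def by (metis mod_mult_self1)
  qed simp
  then have "[(q * q) ^ (s div 2) = 1 ^ (s div 2)] (mod (q + 1))"
    by (rule cong_pow)
  then have "[q ^ s = 1] (mod (q + 1))"
    using assms by (simp flip: power2_eq_square power_mult)
  then have "[a * q ^ s + b = a * 1 + b] (mod (q + 1))"
    by (intro cong_add cong_scalar_left cong_refl)
  then show ?thesis
    by (metis cong_dvd_iff mult.right_neutral)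
qed

text \<open>The digit sum is a multiple of \<open>q + 1\<close>, positive since \<open>i > 0\<close>
  and below \<open>2 * (q + 1)\<close> since both digits are below \<open>q\<close>.\<close>

lemma two_digits_sum:
  fixes q s :: nat
  assumes "even s" "(q + 1) * i = a * q ^ s + b" "a < q" "b < q" "i > 0"
  shows "a + b = q + 1"
proof -
  have "q + 1 dvd a * q ^ s + b"
    by (metis assms(2) dvd_triv_left)
  then have "q + 1 dvd a + b"
    using assms(1) by (simp only: dvd_two_digits_iff)
  then obtain k where k: "a + b = (q + 1) * k" ..
  have "a + b < (q + 1) * 2"
    using assms by simp
  then have "(q + 1) * k < (q + 1) * 2"
    by (simp only: k)
  then have "k < 2"
    by (simp only: mult_less_cancel1)
  moreover have "k \<noteq> 0"
    using assms k by (intro notI) simp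
  ultimately have "k = 1"
    by linarith
  then show ?thesis
    using k by simp
qed

lemma card_multiples:
  fixes q J :: nat
  assumes "q > 0"
  shows "card {i \<in> {1..J}. q dvd i} = J div q"
proof -
  have "{i \<in> {1..J}. q dvd i} = (*) q ` {1..J div q}"
    using assms by (auto simp: less_eq_div_iff_mult_less_eq mult.commute elim!: dvdE)
  then show ?thesis
    using assms by (simp add: card_image inj_on_def)
qed

section \<open>Orbit representatives for the indices from 1 to \<open>J\<close>\<close>

context
  fixes q s J :: nat
  assumes q: "q \<ge> 2" and s: "s \<ge> 2" "even s"
    and J: "(q + 1) * J + q \<le> q ^ (s + 1)" "(q + 1) div 2 * q ^ (s - 1) \<le> J"
begin

text \<open>An index divisible by \<open>q\<close> lies in the orbit of its quotient by
  \<open>q\<close>, so it contributes no new orbit.\<close>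

definition nonmultiples :: "nat set" where
  "nonmultiples = {i \<in> {1..J}. \<not> q dvd i}"

text \<open>The indices to drop: exchanging \<open>a\<close> and \<open>b\<close> by the half turn
  leads to a smaller index of the same orbit.\<close>

definition nonleaders :: "nat set" where
  "nonleaders = {i \<in> nonmultiples. \<exists>a b. a < q \<and> b < a \<and> (q + 1) * i = a * q ^ s + b}"

text \<open>The half turn fixes these indices, so their rotations repeat after \<open>s\<close>
  steps.\<close>

definition selfpaired :: "nat set" where
  "selfpaired = {i \<in> nonmultiples. \<exists>a<q. (q + 1) * i = a * q ^ s + a}"

text \<open>The exponent of \<open>\<alpha>\<close> in \<open>(\<beta> ^ i) ^ q ^ t\<close>, reduced
  modulo the order of \<open>\<alpha>\<close>.\<close>

definition rot :: "nat \<Rightarrow> nat \<Rightarrow> nat" where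
  "rot i t = (q + 1) * i * q ^ t mod (q ^ (2 * s) - 1)"

text \<open>One pair for each element of the union of the orbits, with the rotations of a short
  orbit listed only once.\<close>

definition reps :: "(nat \<times> nat) set" where
  "reps = (nonmultiples - nonleaders - selfpaired) \<times> {..<2 * s} \<union> selfpaired \<times> {..<s}"

lemma nonmultiplesD:
  assumes "i \<in> nonmultiples"
  shows "0 < i" "i \<le> J" "(q + 1) * i < q ^ (s + 1)" "\<not> q dvd (q + 1) * i"
proof -
  show *: "0 < i" "i \<le> J"
    using assms by (auto simp: nonmultiples_def)
  have "(q + 1) * i \<le> (q + 1) * J"
    using * by (intro mult_left_mono) auto
  then show "(q + 1) * i < q ^ (s + 1)"
    using J q by linarith
  have "q dvd (q + 1) * i \<longleftrightarrow> q dvd i"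
    by (simp add: dvd_add_left_iff)
  then show "\<not> q dvd (q + 1) * i"
    using assms by (simp add: nonmultiples_def)
qed

lemma selfpaired_not_nonleader: "i \<in> selfpaired \<Longrightarrow> i \<notin> nonleaders"
proof
  assume "i \<in> selfpaired" "i \<in> nonleaders"
  then obtain a c d where "(q + 1) * i = a * q ^ s + a" "a < q"
    and "(q + 1) * i = c * q ^ s + d" "c < q" "d < c"
    unfolding selfpaired_def nonleaders_def by blast
  then show False
    using two_digits_unique[of a q s a c d] s by simp
qed

lemma cong_power_modulus: "[q ^ (2 * s) = 1] (mod (q ^ (2 * s) - 1))"
  using q by (simp add: cong_altdef_nat)

text \<open>Since \<open>q\<close> is coprime to the modulus, \<open>q ^ t\<close> cancels and a
  rotation by \<open>t' - t < 2 * s\<close> remains. A trivial rotation identifies the indices; any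
  other one is a half turn by \<open>cong_rotation\<close>, which \<open>reps\<close>
  excludes.\<close>

lemma reps_eqI:
  assumes "(i, t) \<in> reps" "(i', t') \<in> reps" "t \<le> t'" "rot i t = rot i' t'"
  shows "(i, t) = (i', t')"
proof -
  have i: "i \<in> nonmultiples - nonleaders" "i' \<in> nonmultiples - nonleaders" and t: "t' < 2 * s"
    using assms selfpaired_not_nonleader by (auto simp: reps_def selfpaired_def)
  have "coprime q (q ^ (2 * s) - 1)"
    using coprime_diff_one_right_nat[of "q ^ (2 * s)"] q s by (simp add: coprime_power_left_iff)
  moreover have "[q ^ t * ((q + 1) * i) = q ^ t * ((q + 1) * i' * q ^ (t' - t))] (mod (q ^ (2 * s) - 1))"
  proof -
    have "q ^ t' = q ^ t * q ^ (t' - t)"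
      using assms(3) by (simp flip: power_add)
    then show ?thesis
      using assms(4) by (simp add: rot_def cong_def mult_ac)
  qed
  ultimately have cong: "[(q + 1) * i = (q + 1) * i' * q ^ (t' - t)] (mod (q ^ (2 * s) - 1))"
    by (subst (asm) cong_mult_lcancel_nat) (simp_all add: coprime_power_left_iff)
  show ?thesis
  proof (cases "t = t'")
    case True
    have "(q + 1) * i < q ^ (2 * s) - 1" "(q + 1) * i' < q ^ (2 * s) - 1"
      using mult_power_less_modulus[of q s _ 0] nonmultiplesD i q s by auto
    then have "(q + 1) * i = (q + 1) * i'"
      using cong True by (simp add: cong_def)
    then have "i = i'"
      by (simp only: mult_cancel1) simp
    with True show ?thesis
      by simp
  next
    case False
    then have "0 < t' - t" "t' - t < 2 * s"
      using assms(3) t by auto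
    then obtain a b where ab: "t' - t = s" "a < q" "b < q"
      "(q + 1) * i = b * q ^ s + a" "(q + 1) * i' = a * q ^ s + b"
      using i nonmultiplesD by (elim cong_rotation[OF q s(1) _ _ _ _ _ _ cong, rotated 4]) auto
    \<comment> \<open>Neither index is in \<open>nonleaders\<close>, so the digits agree. Then
      \<open>i'\<close> is self-paired and \<open>t' < s\<close>, against
      \<open>t' - t = s\<close>.\<close>
    have "\<not> b < a" "\<not> a < b"
      using i ab by (auto simp: nonleaders_def)
    then have "i' \<in> selfpaired"
      using i ab by (auto simp: selfpaired_def)
    then show ?thesis
      using assms(2) ab by (auto simp: reps_def)
  qed
qed

lemma inj_on_rot: "inj_on (\<lambda>(i, t). rot i t) reps"
  by (rule inj_onI) (metis (no_types, lifting) case_prod_beta nle_le prod.collapse reps_eqI)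

lemma rot_mod: "rot i (t mod (2 * s)) = rot i t"
proof -
  have "[(q + 1) * i * (q ^ (t mod (2 * s)) * (q ^ (2 * s)) ^ (t div (2 * s)))
      = (q + 1) * i * (q ^ (t mod (2 * s)) * 1 ^ (t div (2 * s)))] (mod (q ^ (2 * s) - 1))"
    by (intro cong_scalar_left cong_pow cong_power_modulus)
  then show ?thesis
    by (simp add: rot_def cong_def flip: power_mult power_add)
qed

text \<open>The factor \<open>q ^ s\<close> turns \<open>b * q ^ s + a\<close> into
  \<open>b * q ^ (2 * s) + a * q ^ s\<close>, where \<open>q ^ (2 * s)\<close> reduces to 1.\<close>

lemma rot_swap:
  assumes "(q + 1) * i = a * q ^ s + b" "(q + 1) * i' = b * q ^ s + a"
  shows "rot i' (t + s) = rot i t"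
proof -
  have "(q + 1) * i' * q ^ (t + s) = q ^ t * (b * q ^ (2 * s) + a * q ^ s)"
    unfolding assms by (simp add: power_add mult_2 mult_2_right algebra_simps)
  moreover have "[\<dots> = q ^ t * (b * 1 + a * q ^ s)] (mod (q ^ (2 * s) - 1))"
    by (intro cong_scalar_left cong_add cong_refl cong_power_modulus)
  moreover have "q ^ t * (b * 1 + a * q ^ s) = (q + 1) * i * q ^ t"
    unfolding assms by (simp add: algebra_simps)
  ultimately show ?thesis
    by (simp only: rot_def cong_def)
qed

lemma rot_selfpaired_mod:
  assumes "i \<in> selfpaired"
  shows "rot i (t mod s) = rot i t"
proof -
  obtain a where "(q + 1) * i = a * q ^ s + a"
    using assms unfolding selfpaired_def by blast
  then have step: "rot i (u + s) = rot i u" for u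
    by (intro rot_swap)
  have "rot i (u + k * s) = rot i u" for u k
  proof (induction k)
    case (Suc k)
    then show ?case
      using step[of "u + k * s"] by (simp add: add_ac)
  qed simp
  from this[of "t mod s" "t div s"] show ?thesis
    by simp
qed

text \<open>Exchanging the digits keeps their sum \<open>q + 1\<close>, hence divisibility by
  \<open>q + 1\<close>, so the result is again of the form \<open>(q + 1) * i'\<close>. From
  \<open>b < a\<close> it follows that \<open>i' \<le> i\<close>, which keeps \<open>i'\<close>
  within \<open>J\<close>.\<close>

lemma swap_nonleader:
  assumes "i \<in> nonleaders"
  obtains i' where "i' \<in> nonmultiples - nonleaders - selfpaired" "\<And>t. rot i' (t + s) = rot i t"
proof -
  obtain a b where ab: "a < q" "b < a" "(q + 1) * i = a * q ^ s + b" and i: "i \<in> nonmultiples"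
    using assms by (auto simp: nonleaders_def)
  have sum: "a + b = q + 1"
    using two_digits_sum[OF s(2) ab(3)] ab nonmultiplesD[OF i] by simp
  then have "q + 1 dvd b * q ^ s + a"
    using s(2) by (simp only: dvd_two_digits_iff) (simp add: add.commute)
  then obtain i' where i': "(q + 1) * i' = b * q ^ s + a"
    by (metis dvdE)
  have "a < q ^ s" "b < q ^ s" "s > 0"
    using ab self_le_power[of q s] q s by linarith+
  have "b * q ^ s + a \<le> a * q ^ s + b"
  proof -
    have "(b + 1) * q ^ s \<le> a * q ^ s"
      using ab by (intro mult_right_mono) auto
    then show ?thesis
      using \<open>a < q ^ s\<close> by simp
  qed
  then have "(q + 1) * i' \<le> (q + 1) * i"
    using ab i' by simp
  then have "i' \<le> J"
    using nonmultiplesD(2)[OF i] by (simp only: mult_le_cancel1) simp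
  moreover have "i' \<noteq> 0"
    using ab i' by (intro notI) simp
  \<comment> \<open>The last digit of \<open>(q + 1) * i'\<close> is \<open>a\<close>, strictly
    between 0 and \<open>q\<close>.\<close>
  moreover have "\<not> q dvd i'"
  proof
    assume "q dvd i'"
    then have "q dvd b * q ^ s + a"
      by (metis i' dvd_mult)
    then have "q dvd a"
      using s by (simp add: dvd_add_right_iff)
    then show False
      using ab by (auto dest: dvd_imp_le)
  qed
  ultimately have "i' \<in> nonmultiples"
    by (simp add: nonmultiples_def)
  moreover have "i' \<notin> nonleaders \<union> selfpaired"
  proof
    assume "i' \<in> nonleaders \<union> selfpaired"
    then obtain a' b' where "a' < q" "b' \<le> a'" "(q + 1) * i' = a' * q ^ s + b'"
      by (auto simp: nonleaders_def selfpaired_def intro: less_imp_le)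
    then have "b * q ^ s + a = a' * q ^ s + b'" "b' < q"
      using i' by simp_all
    then have "b = a'" "a = b'"
      using two_digits_unique[of b q s a a' b'] ab \<open>s > 0\<close> by blast+
    then show False
      using ab \<open>b' \<le> a'\<close> by simp
  qed
  ultimately show ?thesis
    using that rot_swap[OF ab(3) i'] by blast
qed

text \<open>To reach an arbitrary index, strip its factors \<open>q\<close>, pass to the swapped
  index if it is in \<open>nonleaders\<close>, and reduce the number of rotations modulo the
  period.\<close>

lemma rot_image_reps: "(\<lambda>(i, t). rot i t) ` reps = {rot j t |j t. j \<in> {1..J}}"
proof (intro equalityI subsetI)
  fix x assume "x \<in> (\<lambda>(i, t). rot i t) ` reps"
  then show "x \<in> {rot j t |j t. j \<in> {1..J}}"
    by (auto simp: reps_def nonmultiples_def selfpaired_def)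
next
  have *: "rot i t \<in> (\<lambda>(i, t). rot i t) ` reps" if "i \<in> nonmultiples - nonleaders" for i t
  proof (cases "i \<in> selfpaired")
    case True
    then have "(i, t mod s) \<in> reps"
      using s by (simp add: reps_def)
    then show ?thesis
      using rot_selfpaired_mod[OF True, of t] by (metis (no_types, lifting) case_prod_conv image_eqI)
  next
    case False
    then have "(i, t mod (2 * s)) \<in> reps"
      using s that by (simp add: reps_def)
    then show ?thesis
      using rot_mod[of i t] by (metis (no_types, lifting) case_prod_conv image_eqI)
  qed
  fix x assume "x \<in> {rot j t |j t. j \<in> {1..J}}"
  then obtain j t where x: "x = rot j t" and j: "1 \<le> j" "j \<le> J"
    by auto
  \<comment> \<open>Each factor \<open>q\<close> removed from \<open>j\<close> counts as one further
    rotation.\<close>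
  obtain i m where i: "j = q ^ m * i" "\<not> q dvd i"
  proof (rule multiplicity_decompose'[of j q])
    show "j \<noteq> 0" "\<not> is_unit q"
      using j q by auto
  qed
  have "i > 0"
    using i by (intro gr0I) simp
  moreover have "i \<le> j"
    using i(1) q by (metis le_simps(3) mult_le_mono1 mult_1 One_nat_def zero_less_power pos2
        order_less_le_trans)
  then have "i \<le> J"
    using j by linarith
  ultimately have nonmultiples: "i \<in> nonmultiples"
    using i(2) by (simp add: nonmultiples_def)
  have x_eq: "x = rot i (t + m)"
    by (simp only: x rot_def i(1) power_add mult_ac)
  show "x \<in> (\<lambda>(i, t). rot i t) ` reps"
  proof (cases "i \<in> nonleaders")
    case True
    then show ?thesis
      using swap_nonleader[OF True] * x_eq by (metis Diff_iff)
  next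
    case False
    then show ?thesis
      using * nonmultiples x_eq by simp
  qed
qed

section \<open>Counting the representatives\<close>

lemma card_nonmultiples: "card nonmultiples = J - J div q"
proof -
  have "nonmultiples = {1..J} - {i \<in> {1..J}. q dvd i}"
    by (auto simp: nonmultiples_def)
  also have "card \<dots> = card {1..J} - card {i \<in> {1..J}. q dvd i}"
    by (rule card_Diff_subset) auto
  finally show ?thesis
    using q card_multiples[of q J] by simp
qed

text \<open>The lower bound on \<open>J\<close>, multiplied by \<open>q\<close>. It ensures that the
  subtraction in \<open>card_nonleaders\<close> does not truncate.\<close>

lemma half_le: "(q + 1) div 2 \<le> (q + 1) * J div q ^ s"
proof -
  have "(q + 1) div 2 * q ^ s = q * ((q + 1) div 2 * q ^ (s - 1))"
    using s by (cases s) auto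
  also have "\<dots> \<le> (q + 1) * J"
    using J(2) by (intro mult_mono) auto
  finally show ?thesis
    using q by (simp add: less_eq_div_iff_mult_less_eq)
qed

text \<open>The digit sum is \<open>q + 1\<close>, so the leading digit \<open>a\<close> determines
  the index. The condition \<open>b < a\<close> means \<open>a > (q + 1) div 2\<close>, and
  \<open>i \<le> J\<close> means \<open>a \<le> (q + 1) * J div q ^ s\<close>.\<close>

lemma card_nonleaders: "card nonleaders = (q + 1) * J div q ^ s - (q + 1) div 2"
proof -
  define f where "f = (q + 1) * J div q ^ s"
  \<comment> \<open>The index with leading digit \<open>a\<close> and last digit
    \<open>q + 1 - a\<close>; the division is exact for \<open>a \<le> q\<close>.\<close>
  define g where "g a = (a * q ^ s + (q + 1 - a)) div (q + 1)" for a
  have "(q + 1) * J < q * q ^ s"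
    using J q by simp
  then have "f < q"
    unfolding f_def by (rule less_mult_imp_div_less)
  have g: "(q + 1) * g a = a * q ^ s + (q + 1 - a)" if "a \<le> q" for a
  proof -
    have "q + 1 dvd a * q ^ s + (q + 1 - a)"
      unfolding dvd_two_digits_iff[OF s(2)] using that by simp
    then show ?thesis
      unfolding g_def by (rule dvd_mult_div_cancel)
  qed
  have "nonleaders = g ` {(q + 1) div 2 <.. f}"
  proof (intro equalityI subsetI)
    fix i assume "i \<in> nonleaders"
    then obtain a b where ab: "a < q" "b < a" "(q + 1) * i = a * q ^ s + b" and i: "i \<in> nonmultiples"
      by (auto simp: nonleaders_def)
    have sum: "a + b = q + 1"
      using two_digits_sum[OF s(2) ab(3)] ab nonmultiplesD[OF i] by simp
    have "(q + 1) * i \<le> (q + 1) * J"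
      using nonmultiplesD[OF i] by (intro mult_left_mono) auto
    then have "a * q ^ s \<le> (q + 1) * J"
      using ab(3) by linarith
    then have "a \<le> f"
      using q by (simp add: f_def less_eq_div_iff_mult_less_eq)
    moreover have "(q + 1) * i = (q + 1) * g a"
      using ab g[of a] sum by simp
    then have "i = g a"
      by (simp only: mult_cancel1) simp
    ultimately show "i \<in> g ` {(q + 1) div 2 <.. f}"
      using ab sum by auto
  next
    fix i assume "i \<in> g ` {(q + 1) div 2 <.. f}"
    then obtain a where a: "i = g a" "(q + 1) div 2 < a" "a \<le> f"
      by auto
    define b where "b = q + 1 - a"
    have b: "a < q" "b < a" "1 < b" "b < q" "a + b = q + 1"
      using a \<open>f < q\<close> by (auto simp: b_def)
    have i: "(q + 1) * i = a * q ^ s + b"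
      using g[of a] a b by (simp add: b_def)
    have "a * q ^ s \<le> (q + 1) * J"
      using a q by (simp add: f_def less_eq_div_iff_mult_less_eq)
    \<comment> \<open>The bound on \<open>a\<close> controls only the leading part. The last digit
      \<open>b\<close> fits as well: \<open>a + r\<close> is a positive multiple of
      \<open>q + 1 = a + b\<close>, so \<open>b \<le> r\<close>.\<close>
    then obtain r where r: "(q + 1) * J = a * q ^ s + r"
      using le_Suc_ex by blast
    have "q + 1 dvd a * q ^ s + r"
      by (metis r dvd_triv_left)
    then have "q + 1 dvd a + r"
      using s(2) by (simp only: dvd_two_digits_iff)
    then have "q + 1 \<le> a + r"
      using b by (intro dvd_imp_le) auto
    then have "(q + 1) * i \<le> (q + 1) * J"
      using i r b by linarith
    then have "i \<le> J"
      by (simp only: mult_le_cancel1)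
    moreover have "i \<noteq> 0"
      using b i by (intro notI) simp
    moreover have "\<not> q dvd i"
    proof
      assume "q dvd i"
      then have "q dvd a * q ^ s + b"
        by (metis i dvd_mult)
      then have "q dvd b"
        using s by (simp add: dvd_add_right_iff)
      then show False
        using b by (auto dest: dvd_imp_le)
    qed
    ultimately have "i \<in> nonmultiples"
      by (simp add: nonmultiples_def)
    then show "i \<in> nonleaders"
      unfolding nonleaders_def using b i by blast
  qed
  moreover have "inj_on g {(q + 1) div 2 <.. f}"
  proof (rule inj_onI)
    fix a a' assume *: "a \<in> {(q + 1) div 2 <.. f}" "a' \<in> {(q + 1) div 2 <.. f}" "g a = g a'"
    then have "a * q ^ s + (q + 1 - a) = a' * q ^ s + (q + 1 - a')"
      using g[of a] g[of a'] \<open>f < q\<close> by simp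
    then show "a = a'"
      using * s q by (intro two_digits_unique(1)[of a q s "q + 1 - a" a' "q + 1 - a'"]) auto
  qed
  ultimately show ?thesis
    by (simp add: card_image f_def)
qed

text \<open>The digit sum gives \<open>2 * a = q + 1\<close>. This is impossible for even
  \<open>q\<close>, and for odd \<open>q\<close> it leaves only
  \<open>i = (q ^ s + 1) / 2\<close>.\<close>

lemma card_selfpaired: "card selfpaired = (if odd q then 1 else 0)"
proof -
  have sum: "2 * a = q + 1" if "i \<in> selfpaired" "a < q" "(q + 1) * i = a * q ^ s + a" for i a
  proof -
    have "0 < i"
      using that(1) nonmultiplesD(1) by (simp add: selfpaired_def)
    then have "a + a = q + 1"
      using two_digits_sum[OF s(2) that(3)] that(2) by blast
    then show ?thesis
      by simp
  qed
  show ?thesis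
  proof (cases "odd q")
    case False
    have "selfpaired = {}"
    proof (rule equals0I)
      fix i assume "i \<in> selfpaired"
      then obtain a where "2 * a = q + 1"
        using sum unfolding selfpaired_def by blast
      then show False
        using False by presburger
    qed
    then show ?thesis
      using False by simp
  next
    case True
    then have "even (q + 1)" "even (q ^ s + 1)"
      by simp_all
    then obtain a i where a: "q + 1 = 2 * a" and i: "q ^ s + 1 = 2 * i"
      unfolding dvd_def by blast
    have eq: "(q + 1) * i = a * q ^ s + a"
    proof -
      have "(q + 1) * i = a * (2 * i)"
        unfolding a by simp
      also have "\<dots> = a * (q ^ s + 1)"
        by (simp only: i)
      finally show ?thesis
        by simp
    qed
    have "a < q"
      using a q True by presburger
    \<comment> \<open>The lower bound on \<open>J\<close> places this index in range, since
      \<open>q ^ s + 1 \<le> (q + 1) * q ^ (s - 1)\<close>.\<close>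
    have "2 * i \<le> 2 * J"
    proof -
      have "2 * i = q * q ^ (s - 1) + 1"
        unfolding i[symmetric] using s by (cases s) auto
      also have "\<dots> \<le> q * q ^ (s - 1) + q ^ (s - 1)"
        using q by simp
      also have "\<dots> = (q + 1) * q ^ (s - 1)"
        by simp
      also have "\<dots> = 2 * ((q + 1) div 2 * q ^ (s - 1))"
        unfolding a by simp
      finally show ?thesis
        using J(2) by linarith
    qed
    moreover have "i \<noteq> 0"
      using i by (intro notI) simp
    moreover have "\<not> q dvd i"
    proof
      assume "q dvd i"
      then have "q dvd q ^ s + 1"
        unfolding i by simp
      then have "q dvd 1"
        using s by (subst (asm) dvd_add_right_iff) auto
      then show False
        using q by simp
    qed
    ultimately have "i \<in> nonmultiples"
      by (simp add: nonmultiples_def)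
    then have "i \<in> selfpaired"
      unfolding selfpaired_def using eq \<open>a < q\<close> by blast
    moreover have "j = i" if "j \<in> selfpaired" for j
    proof -
      from \<open>j \<in> selfpaired\<close> obtain a' where a': "a' < q" "(q + 1) * j = a' * q ^ s + a'"
        unfolding selfpaired_def by blast
      then have "a' = a"
        using sum[OF that a'] a by linarith
      then have "(q + 1) * j = (q + 1) * i"
        using a'(2) by (simp only: eq \<open>a' = a\<close>)
      then show ?thesis
        by (simp only: mult_cancel1) simp
    qed
    ultimately have "selfpaired = {i}"
      by blast
    then show ?thesis
      using True by simp
  qed
qed

text \<open>Each representative contributes \<open>2 * s\<close> elements, except that the one short
  orbit for odd \<open>q\<close> lacks \<open>s\<close> of them. The negative terms are moved to the
  left to avoid truncated subtraction.\<close>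

lemma card_cyclotomic_cosets:
  "card {(q + 1) * j * q ^ t mod (q ^ (2 * s) - 1) |j t. j \<in> {1..J}} + 2 * s * (J div q) + 2 * s * ((q + 1) * J div q ^ s)
    + (if odd q then s else 0) = 2 * s * J + 2 * s * ((q + 1) div 2)"
proof -
  have fin: "finite nonmultiples"
    by (simp add: nonmultiples_def)
  have sub: "nonleaders \<subseteq> nonmultiples" "selfpaired \<subseteq> nonmultiples - nonleaders"
    using selfpaired_not_nonleader by (auto simp: nonleaders_def selfpaired_def)
  have fin': "finite nonleaders" "finite selfpaired"
    using sub fin by (auto intro: finite_subset)
  have "card {(q + 1) * j * q ^ t mod (q ^ (2 * s) - 1) |j t. j \<in> {1..J}} = card reps"
    unfolding rot_def[symmetric] rot_image_reps[symmetric] by (rule card_image[OF inj_on_rot])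
  also have "\<dots> = card (nonmultiples - nonleaders - selfpaired) * (2 * s) + card selfpaired * s"
    unfolding reps_def using fin fin' by (subst card_Un_disjoint) (auto simp: card_cartesian_product)
  finally have card: "card {(q + 1) * j * q ^ t mod (q ^ (2 * s) - 1) |j t. j \<in> {1..J}}
      = card (nonmultiples - nonleaders - selfpaired) * (2 * s) + card selfpaired * s" .
  define r where "r = card (nonmultiples - nonleaders - selfpaired)"
  have "card nonmultiples = r + card selfpaired + card nonleaders"
    using sub fin fin' card_mono[OF fin sub(1)] card_mono[OF _ sub(2)]
    by (simp add: r_def card_Diff_subset)
  then have "J + (q + 1) div 2 = r + (if odd q then 1 else 0) + J div q + (q + 1) * J div q ^ s"
    using card_nonmultiples card_nonleaders card_selfpaired half_le div_le_dividend[of J q] by linarith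
  then have "2 * s * (J + (q + 1) div 2)
      = 2 * s * (r + (if odd q then 1 else 0) + J div q + (q + 1) * J div q ^ s)"
    by simp
  then show ?thesis
    unfolding card r_def[symmetric] card_selfpaired by (cases "odd q") (simp_all add: algebra_simps)
qed

end

subsection \<open>The dimension formula\<close>

lemma ceiling_half_nat: "\<lceil>real q / 2\<rceil> = int ((q + 1) div 2)"
  unfolding ceiling_eq_iff by (cases "even q") (auto elim!: evenE oddE)

text \<open>Exponents reduce modulo \<open>CARD('l) - 1\<close>, so the exponents below this number
  already give all nonzero elements. There are equally many of both, hence no power repeats.\<close>

lemma generator_powers:
  fixes \<alpha> :: "'l::{finite,field}"
  assumes "field_generator \<alpha>"
  shows "\<alpha> ^ (CARD('l) - 1) = 1" "inj_on (\<lambda>i. \<alpha> ^ i) {..<CARD('l) - 1}"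
    and "\<alpha> ^ (i mod (CARD('l) - 1)) = \<alpha> ^ i"
proof -
  have "\<alpha> \<in> range (\<lambda>i::nat. \<alpha> ^ i)"
    by (rule range_eqI[of _ _ 1]) simp
  then have "\<alpha> \<noteq> 0"
    using assms by (auto simp: field_generator_def)
  have "Suc (CARD('l) - 1) = CARD('l)"
    by simp
  then have "\<alpha> * \<alpha> ^ (CARD('l) - 1) = \<alpha>"
    using finite_field_power_card[of \<alpha>] by (metis power_Suc)
  then show one: "\<alpha> ^ (CARD('l) - 1) = 1"
    using \<open>\<alpha> \<noteq> 0\<close> by simp
  show mod: "\<alpha> ^ (i mod (CARD('l) - 1)) = \<alpha> ^ i" for i
  proof -
    have "\<alpha> ^ i = \<alpha> ^ (i mod (CARD('l) - 1)) * (\<alpha> ^ (CARD('l) - 1)) ^ (i div (CARD('l) - 1))"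
      by (simp only: mod_mult_div_eq flip: power_mult power_add)
    then show ?thesis
      using one by simp
  qed
  have "CARD('l) \<ge> card {0, 1 :: 'l}"
    by (intro card_mono) auto
  then have "CARD('l) - 1 > 0"
    by simp
  then have "\<alpha> ^ i \<in> (\<lambda>i. \<alpha> ^ i) ` {..<CARD('l) - 1}" for i
    by (intro image_eqI[of _ _ "i mod (CARD('l) - 1)"]) (simp_all only: mod lessThan_iff mod_less_divisor)
  then have "range (\<lambda>i::nat. \<alpha> ^ i) = (\<lambda>i. \<alpha> ^ i) ` {..<CARD('l) - 1}"
    by blast
  then have "card ((\<lambda>i. \<alpha> ^ i) ` {..<CARD('l) - 1}) = card (UNIV - {0::'l})"
    using assms by (simp add: field_generator_def)
  then show "inj_on (\<lambda>i. \<alpha> ^ i) {..<CARD('l) - 1}"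
    by (intro eq_card_imp_inj_on) (simp_all add: card_Diff_subset)
qed

text \<open>Every \<open>\<beta> ^ j\<close> is a root of \<open>x ^ n - 1\<close>, so the minimal
  polynomials and their \<open>Lcm\<close> divide it, and the dimension and degree formulas
  combine.\<close>

lemma code_dim_bch_code:
  fixes \<phi> :: "'k::{finite,field_gcd} \<Rightarrow> 'l::{finite,field}"
  assumes emb: "field_embedding \<phi>" and "primepow CARD('k)" "n > 0" "\<beta> ^ n = 1"
  shows "code_dim (bch_code \<phi> \<beta> n \<delta>)
    + card {x ^ CARD('k) ^ t |x t. x \<in> (\<lambda>j. \<beta> ^ j) ` {1..\<delta> - 1}} = n"
proof -
  let ?f = "monom 1 n - 1 :: 'k poly"
  have "coeff ?f n = 1"
    using \<open>n > 0\<close> by simp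
  then have "?f \<noteq> 0"
    by (metis coeff_0 zero_neq_one)
  have "poly (map_poly \<phi> ?f) (\<beta> ^ j) = 0" for j
  proof -
    have "(\<beta> ^ j) ^ n = 1"
      using \<open>\<beta> ^ n = 1\<close> by (metis power_commutes power_mult mult.commute power_one)
    then show ?thesis
      by (simp add: map_poly_emb_diff[OF emb] map_poly_monom emb_0[OF emb] emb_1[OF emb] poly_monom)
  qed
  then have "Lcm ((\<lambda>j. min_poly \<phi> (\<beta> ^ j)) ` {1..\<delta> - 1}) dvd ?f"
    using min_poly_props(3)[OF emb \<open>?f \<noteq> 0\<close>] by (intro Lcm_least) blast
  from code_dim_cyclic_code[OF \<open>n > 0\<close> this] show ?thesis
    using degree_Lcm_min_poly[OF assms(1,2), of "(\<lambda>j. \<beta> ^ j) ` {1..\<delta> - 1}"]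
    by (simp add: bch_code_def image_image)
qed

theorem theorem24:
  fixes \<phi> :: "'k::{finite,field_gcd} \<Rightarrow> 'l::{finite,field}"
    and \<alpha> \<beta> :: 'l
    and q s n \<delta> k :: nat
  assumes "primepow q"
    and "CARD('k) = q"
    and "CARD('l) = q ^ (2 * s)"
    and "field_embedding \<phi>"
    and "field_generator \<alpha>"
    and "\<beta> = \<alpha> ^ (q + 1)"
    and "s \<ge> 4" and "even s"
    and "real n = (real q ^ (2 * s) - 1) / (real q + 1)"
    and "real_of_int \<lceil>real q / 2\<rceil> * real q ^ (s - 1) + 1 \<le> real \<delta>"
    and "real \<delta> \<le> (real q ^ (s + 1) + 1) / (real q + 1)"
    and "k = code_dim (bch_code \<phi> \<beta> n \<delta>)"
  shows "(even q \<longrightarrow>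
            real k = real n
              - 2 * real s * (real \<delta> + (real q - 2) / 2
                   - real_of_int \<lfloor>(real \<delta> - 1) * (real q + 1) / real q ^ s\<rfloor>)
              + 2 * real s * real_of_int \<lfloor>(real \<delta> - 1) / real q\<rfloor>)
       \<and> (odd q \<longrightarrow>
            real k = real n
              - 2 * real s * (real \<delta> + (real q - 1) / 2
                   - real_of_int \<lfloor>(real \<delta> - 1) * (real q + 1) / real q ^ s\<rfloor>)
              + 2 * real s * real_of_int \<lfloor>(real \<delta> - 1) / real q\<rfloor>
              + real s)"
proof -
  have q: "q \<ge> 2"
    using assms(1) primepow_gt_Suc_0[of q] by simp
  define J where "J = \<delta> - 1"
  \<comment> \<open>Makes the truncated subtraction \<open>\<delta> - 1\<close> exact.\<close>
  have "real \<delta> \<ge> 1"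
    by (rule order_trans[OF _ assms(10)]) (simp add: ceiling_half_nat)
  then have \<delta>: "real \<delta> = real J + 1"
    by (simp add: J_def of_nat_diff)
  have "real ((q + 1) div 2 * q ^ (s - 1)) \<le> real J"
    using assms(10) by (simp add: ceiling_half_nat \<delta>)
  then have J1: "(q + 1) div 2 * q ^ (s - 1) \<le> J"
    by (simp only: of_nat_le_iff)
  have "real \<delta> * (real q + 1) \<le> real q ^ (s + 1) + 1"
    using assms(11) by (simp add: pos_le_divide_eq)
  then have "real ((q + 1) * J + q) \<le> real (q ^ (s + 1))"
    by (simp add: \<delta> algebra_simps)
  then have J2: "(q + 1) * J + q \<le> q ^ (s + 1)"
    by (simp only: of_nat_le_iff)
  have "real n * (real q + 1) = real q ^ (2 * s) - 1"
    using assms(9) by (simp add: field_simps)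
  then have "real (n * (q + 1) + 1) = real (q ^ (2 * s))"
    by (simp add: algebra_simps)
  then have n: "n * (q + 1) + 1 = q ^ (2 * s)"
    by (simp only: of_nat_eq_iff)
  have "1 < q ^ (2 * s)"
    using q assms(7) by (intro one_less_power) auto
  then have "n \<noteq> 0"
    using n by (intro notI) simp
  then have N: "0 < n" "(q + 1) * n = CARD('l) - 1" "CARD('l) - 1 = q ^ (2 * s) - 1"
    using n assms(3) by (auto simp: mult.commute)
  note \<alpha> = generator_powers[OF assms(5)]
  have "\<beta> ^ n = 1"
    using \<alpha>(1) N by (simp only: assms(6) flip: power_mult)
  have eq: "(\<beta> ^ j) ^ q ^ t = \<alpha> ^ ((q + 1) * j * q ^ t mod (q ^ (2 * s) - 1))" for j t
    using \<alpha>(3)[of "(q + 1) * j * q ^ t"] N by (simp only: assms(6) flip: power_mult)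
  \<comment> \<open>Passing to exponents of the generator is injective below its order, so roots can
    be counted as residues.\<close>
  have "{x ^ q ^ t |x t. x \<in> (\<lambda>j. \<beta> ^ j) ` {1..J}} = (\<lambda>i. \<alpha> ^ i) ` {(q + 1) * j * q ^ t mod (q ^ (2 * s) - 1) |j t. j \<in> {1..J}}"
    (is "?Z = _ ` ?R")
  proof -
    have "?Z = {(\<beta> ^ j) ^ q ^ t |j t. j \<in> {1..J}}"
      by blast
    also have "\<dots> = {\<alpha> ^ ((q + 1) * j * q ^ t mod (q ^ (2 * s) - 1)) |j t. j \<in> {1..J}}"
      by (simp only: eq)
    also have "\<dots> = (\<lambda>i. \<alpha> ^ i) ` ?R"
      by blast
    finally show ?thesis .
  qed
  moreover have "inj_on (\<lambda>i. \<alpha> ^ i) ?R"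
    by (rule inj_on_subset[OF \<alpha>(2)]) (use N n q in auto)
  ultimately have "card ?Z = card ?R"
    by (simp only: card_image)
  moreover have "k + card ?Z = n"
    using code_dim_bch_code[OF assms(4) _ N(1) \<open>\<beta> ^ n = 1\<close>, of \<delta>] assms(1)
    unfolding assms(2) assms(12)[symmetric] J_def[symmetric] by blast
  ultimately have k: "k + card ?R = n"
    by simp
  define f g where "f = (q + 1) * J div q ^ s" and "g = J div q"
  have floor_f: "\<lfloor>(real \<delta> - 1) * (real q + 1) / real q ^ s\<rfloor> = int f"
    using floor_divide_of_nat_eq[of "(q + 1) * J" "q ^ s"] by (simp add: \<delta> f_def algebra_simps)
  have floor_g: "\<lfloor>(real \<delta> - 1) / real q\<rfloor> = int g"
    using floor_divide_of_nat_eq[of J q] by (simp add: \<delta> g_def)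
  define w h where "w = card ?R" and "h = (q + 1) div 2"
  have "w + 2 * s * g + 2 * s * f + (if odd q then s else 0) = 2 * s * J + 2 * s * h"
    unfolding f_def g_def w_def h_def using card_cyclotomic_cosets[OF q _ assms(8) J2 J1] assms(7) by simp
  then have w: "real (w + 2 * s * g + 2 * s * f + (if odd q then s else 0)) = real (2 * s * J + 2 * s * h)"
    by (rule arg_cong)
  have n_eq: "real n = real k + real w"
    using k by (simp add: w_def flip: of_nat_add)
  \<comment> \<open>The -1 absorbs the shift from \<open>J\<close> to \<open>\<delta>\<close>: in
    both parities \<open>\<delta> + (h - 1) = J + h\<close>.\<close>
  have h: "(real q - 2) / 2 = real h - 1" if "even q"
    using that by (auto simp: h_def elim!: evenE)
  have h': "(real q - 1) / 2 = real h - 1" if "odd q"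
    using that by (auto simp: h_def elim!: oddE)
  show ?thesis
    unfolding floor_f floor_g
  proof (intro conjI impI)
    assume "even q"
    then show "real k = real n - 2 * real s * (real \<delta> + (real q - 2) / 2 - real_of_int (int f))
        + 2 * real s * real_of_int (int g)"
      using w n_eq by (simp add: h \<delta> algebra_simps)
  next
    assume "odd q"
    then show "real k = real n - 2 * real s * (real \<delta> + (real q - 1) / 2 - real_of_int (int f))
        + 2 * real s * real_of_int (int g) + real s"
      using w n_eq by (simp add: h' \<delta> algebra_simps)
  qed
qed

end
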